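(* Let $(d_1,\ldots,d_n)\in\mathbb{N}^n$, let $m=\sum_{i=1}^n d_i$, and let $k$ be a positive integer. Let \[ \mathcal{C}\subseteq\Bigl\{(x_1,\ldots,x_n)\in\mathbb{N}^n \;:\; 0\le x_i\le d_i \text{ for all } i,\ \textstyle\sum_i x_i=k\Bigr\}. \] Define \[ f_{\mathrm{lin}}(x_1,\ldots,x_n)=\sum_i x_i\lg d_i,\qquad f_{\mathrm{ent}}(x_1,\ldots,x_n)=-\sum_i (d_i-x_i)\lg\Bigl(\frac{d_i-x_i}{m-k}\Bigr)=H(d_1-x_1,\ldots,d_n-x_n). \] Then for every $(x_1,\ldots,x_n)\in\mathcal{C}$, \[ f_{\mathrm{ent}}(x)-\frac{k}{\ln 2}\;\le\;(m-k)\lg(m-k)-\sum_i d_i\lg d_i+f_{\mathrm{lin}}(x)\;\le\;f_{\mathrm{ent}}(x). \] Consequently, if $\hat x\in\mathcal{C}$ minimises $f_{\mathrm{lin}}$ over $\mathcal{C}$, then $f_{\mathrm{ent}}(\hat x)\le \min_{x\in\mathcal{C}} f_{\mathrm{ent}}(x)+k/\ln 2$.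
   Context: $\lg=\log_2$. For nonnegative numbers $a_1,\ldots,a_n$ with $s=\sum_i a_i$, $H(a_1,\ldots,a_n)=\sum_i a_i\lg(s/a_i)$ (the unnormalised empirical entropy). Throughout the convention $x\lg x=x\lg(1/x)=0$ for $x=0$ is used (so terms with $d_i-x_i=0$, or with $x_i=0$ and $d_i=0$, contribute $0$). *)

theory Defs
  imports Complex_Main "HOL-Library.FuncSet"
begin

text \<open>
  An \<open>n\<close>-tuple is a function on the index set \<open>{1..n}\<close>; where tuples are collected in a
  set, they are extensional, so that the set of tuples is isomorphic to \<open>\<nat>\<^sup>n\<close>.

  For nonnegative entries and bounded tuples, all logarithmic terms below have the form \<open>a * log 2 b\<close> with \<open>a = 0\<close> whenever \<open>b\<close> is not
  positive, so the convention \<open>0 lg 0 = 0 lg (1/0) = 0\<close> holds because the factor \<open>a\<close> is \<open>0\<close>.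
\<close>

definition emp_entropy :: "nat \<Rightarrow> (nat \<Rightarrow> real) \<Rightarrow> real" where
  "emp_entropy n a = (\<Sum>i = 1..n. a i * log 2 ((\<Sum>j = 1..n. a j) / a i))"

definition bounded_tuples :: "nat \<Rightarrow> (nat \<Rightarrow> nat) \<Rightarrow> nat \<Rightarrow> (nat \<Rightarrow> nat) set" where
  "bounded_tuples n d k =
     {x \<in> {1..n} \<rightarrow>\<^sub>E UNIV. (\<forall>i \<in> {1..n}. x i \<le> d i) \<and> (\<Sum>i = 1..n. x i) = k}"

definition f_lin :: "nat \<Rightarrow> (nat \<Rightarrow> nat) \<Rightarrow> (nat \<Rightarrow> nat) \<Rightarrow> real" where
  "f_lin n d x = (\<Sum>i = 1..n. real (x i) * log 2 (real (d i)))"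

definition f_ent :: "nat \<Rightarrow> (nat \<Rightarrow> nat) \<Rightarrow> nat \<Rightarrow> nat \<Rightarrow> (nat \<Rightarrow> nat) \<Rightarrow> real" where
  "f_ent n d m k x =
     - (\<Sum>i = 1..n. (real (d i) - real (x i)) *
          log 2 ((real (d i) - real (x i)) / (real m - real k)))"

text \<open>Finiteness makes \<open>Min\<close> over the image of a set of bounded tuples meaningful.\<close>

lemma finite_bounded_tuples: "finite (bounded_tuples n d k)"
proof (rule finite_subset)
  show "bounded_tuples n d k \<subseteq> (\<Pi>\<^sub>E i \<in> {1..n}. {..d i})"
    by (auto simp: bounded_tuples_def PiE_def Pi_def)
  show "finite (\<Pi>\<^sub>E i \<in> {1..n}. {..d i})"
    by (intro finite_PiE) auto
qed

end

theory Submission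
  imports Defs
begin

text \<open>
  The gap between \<open>f_ent n d m k x\<close> and the middle expression is
  \<open>\<Sum>i. (d i - x i) * log 2 (d i / (d i - x i))\<close>. Its terms are nonnegative, and
  \<open>ln t \<le> t - 1\<close> bounds the term of index \<open>i\<close> by \<open>x i / ln 2\<close>; the \<open>x i\<close> sum to \<open>k\<close>.
\<close>

lemma mult_log_diff_bounds:
  fixes d e b :: real
  assumes "0 \<le> e" "e \<le> d" "1 < b"
  shows "0 \<le> e * (log b d - log b e)" "e * (log b d - log b e) \<le> (d - e) / ln b"
proof -
  have "0 \<le> e * (log b d - log b e) \<and> e * (log b d - log b e) \<le> (d - e) / ln b"
  \<comment> \<open>The quotient \<open>d / e\<close> makes sense only for positive
    \<open>e\<close>. For \<open>e = 0\<close> the product vanishes and the upper bound is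
    \<open>d / ln b\<close>, which is nonnegative.\<close>
  proof (cases "e = 0")
    case True
    with assms show ?thesis by simp
  next
    case False
    with assms have pos: "0 < e" "0 < d" by auto
    have "ln d - ln e \<le> d / e - 1"
      using ln_le_minus_one[of "d / e"] pos by (simp add: ln_div)
    then have "e * (ln d - ln e) \<le> e * (d / e - 1)"
      using pos by (intro mult_left_mono) auto
    then have "e * (ln d - ln e) \<le> d - e"
      using pos by (simp add: right_diff_distrib)
    then have "e * (ln d - ln e) / ln b \<le> (d - e) / ln b"
      using assms(3) by (intro divide_right_mono) auto
    then have "e * (log b d - log b e) \<le> (d - e) / ln b"
      by (simp add: log_def diff_divide_distrib right_diff_distrib)
    moreover have "log b e \<le> log b d"
      using pos assms by simp
    ultimately show ?thesis using pos by simp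
  qed
  then show "0 \<le> e * (log b d - log b e)" "e * (log b d - log b e) \<le> (d - e) / ln b"
    by auto
qed

lemma sum_diff_bounded_tuples:
  assumes "x \<in> bounded_tuples n d k"
  shows "(\<Sum>i = 1..n. real (d i) - real (x i)) = real (\<Sum>i = 1..n. d i) - real k"
  using assms by (auto simp: bounded_tuples_def sum_subtractf)

text \<open>The differences \<open>d i - x i\<close> add up to \<open>m - k\<close>, so the
  normaliser in \<open>f_ent\<close> is the total that \<open>emp_entropy\<close> divides by its
  entries.\<close>

lemma f_ent_eq_emp_entropy:
  assumes "m = (\<Sum>i = 1..n. d i)" "x \<in> bounded_tuples n d k"
  shows "f_ent n d m k x = emp_entropy n (\<lambda>i. real (d i) - real (x i))"
proof -
  define e where "e i = real (d i) - real (x i)" for i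
  have sum_e: "(\<Sum>i = 1..n. e i) = real m - real k"
    using sum_diff_bounded_tuples[OF assms(2)] assms(1) by (simp add: e_def)
  \<comment> \<open>Inverting the quotient absorbs the outer minus sign of
    \<open>f_ent\<close>.\<close>
  have "- (e i * log 2 (e i / (real m - real k))) = e i * log 2 ((real m - real k) / e i)" for i
    using log_inverse[of 2 "e i / (real m - real k)"] by simp
  then show ?thesis
    unfolding f_ent_def emp_entropy_def e_def[symmetric] sum_e sum_negf[symmetric] by simp
qed

text \<open>Splitting the logarithm of each quotient isolates
  \<open>(m - k) * log 2 (m - k)\<close>, which then cancels against the same term of the middle
  expression.\<close>

lemma f_ent_expand:
  assumes "m = (\<Sum>i = 1..n. d i)" "x \<in> bounded_tuples n d k"
  shows "f_ent n d m k x = (real m - real k) * log 2 (real m - real k)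
           - (\<Sum>i = 1..n. (real (d i) - real (x i)) * log 2 (real (d i) - real (x i)))"
proof -
  define e where "e i = real (d i) - real (x i)" for i
  have sum_e: "(\<Sum>i = 1..n. e i) = real m - real k"
    using sum_diff_bounded_tuples[OF assms(2)] assms(1) by (simp add: e_def)
  have e_nonneg: "0 \<le> e i" if "i \<in> {1..n}" for i
    using assms(2) that by (auto simp: bounded_tuples_def e_def)
  have "e i * log 2 (e i / (real m - real k)) = e i * log 2 (e i) - e i * log 2 (real m - real k)"
    if i: "i \<in> {1..n}" for i
  proof (cases "e i = 0")
    case False
    then have "0 < e i" using e_nonneg[OF i] by simp
    \<comment> \<open>A single positive entry forces \<open>m - k\<close> to be positive, as
      \<open>log_divide\<close> requires. If \<open>m = k\<close>, every \<open>e i\<close> is 0 and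
      only the other case occurs.\<close>
    moreover have "e i \<le> real m - real k"
      unfolding sum_e[symmetric] using i e_nonneg by (intro member_le_sum) auto
    ultimately show ?thesis by (simp add: log_divide right_diff_distrib)
  qed simp
  then have "(\<Sum>i = 1..n. e i * log 2 (e i / (real m - real k)))
      = (\<Sum>i = 1..n. e i * log 2 (e i) - e i * log 2 (real m - real k))"
    by (intro sum.cong) auto
  also have "\<dots> = (\<Sum>i = 1..n. e i * log 2 (e i)) - (real m - real k) * log 2 (real m - real k)"
    by (simp only: sum_subtractf sum_distrib_right[symmetric] sum_e)
  finally show ?thesis
    unfolding f_ent_def e_def[symmetric] by simp
qed

text \<open>The tuple \<open>x\<close> enters \<open>g\<close> only through
  \<open>f_lin n d x\<close>, so minimising \<open>f_lin\<close> is the same as minimising an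
  approximation of \<open>f_ent\<close>.\<close>

lemma f_ent_f_lin_bounds:
  assumes "m = (\<Sum>i = 1..n. d i)" "x \<in> bounded_tuples n d k"
  defines "g \<equiv> (real m - real k) * log 2 (real m - real k)
                 - (\<Sum>i = 1..n. real (d i) * log 2 (real (d i))) + f_lin n d x"
  shows "f_ent n d m k x - real k / ln 2 \<le> g" "g \<le> f_ent n d m k x"
proof -
  define t where "t i = (real (d i) - real (x i))
    * (log 2 (real (d i)) - log 2 (real (d i) - real (x i)))" for i
  \<comment> \<open>The sum in \<open>g\<close> and \<open>f_lin\<close> merge index by index:
    \<open>d i * log 2 (d i) - x i * log 2 (d i)\<close> has the weight \<open>d i - x i\<close>,
    the same as in \<open>f_ent\<close>.\<close>
  have gap: "f_ent n d m k x - g = (\<Sum>i = 1..n. t i)"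
    unfolding f_ent_expand[OF assms(1,2)] g_def f_lin_def t_def
    by (simp add: algebra_simps sum.distrib sum_subtractf)
  have t: "0 \<le> t i \<and> t i \<le> real (x i) / ln 2" if "i \<in> {1..n}" for i
    using mult_log_diff_bounds[of "real (d i) - real (x i)" "real (d i)" 2] assms(2) that
    by (auto simp: t_def bounded_tuples_def)
  have "(\<Sum>i = 1..n. t i) \<le> (\<Sum>i = 1..n. real (x i) / ln 2)"
    using t by (intro sum_mono) auto
  also have "\<dots> = real k / ln 2"
    using assms(2) by (auto simp: bounded_tuples_def sum_divide_distrib[symmetric])
  finally show "f_ent n d m k x - real k / ln 2 \<le> g"
    using gap by simp
  have "0 \<le> (\<Sum>i = 1..n. t i)"
    using t by (intro sum_nonneg) auto
  then show "g \<le> f_ent n d m k x"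
    using gap by simp
qed

theorem theorem1:
  fixes n m k :: nat and d :: "nat \<Rightarrow> nat" and C :: "(nat \<Rightarrow> nat) set"
  assumes "m = (\<Sum>i = 1..n. d i)"
    and "k > 0"
    and "C \<subseteq> bounded_tuples n d k"
  shows "(\<forall>x \<in> C.
            f_ent n d m k x = emp_entropy n (\<lambda>i. real (d i) - real (x i)) \<and>
            f_ent n d m k x - real k / ln 2
              \<le> (real m - real k) * log 2 (real m - real k)
                  - (\<Sum>i = 1..n. real (d i) * log 2 (real (d i))) + f_lin n d x \<and>
            (real m - real k) * log 2 (real m - real k)
                  - (\<Sum>i = 1..n. real (d i) * log 2 (real (d i))) + f_lin n d x
              \<le> f_ent n d m k x) \<and>
         (\<forall>xhat. is_arg_min (f_lin n d) (\<lambda>x. x \<in> C) xhat \<longrightarrow>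
            f_ent n d m k xhat \<le> Min (f_ent n d m k ` C) + real k / ln 2)"
proof (intro conjI ballI allI impI)
  fix x assume "x \<in> C"
  then have x: "x \<in> bounded_tuples n d k" using assms(3) by auto
  note f_ent_eq_emp_entropy[OF assms(1) x] f_ent_f_lin_bounds[OF assms(1) x]
  then show "f_ent n d m k x = emp_entropy n (\<lambda>i. real (d i) - real (x i))"
    "f_ent n d m k x - real k / ln 2
      \<le> (real m - real k) * log 2 (real m - real k)
          - (\<Sum>i = 1..n. real (d i) * log 2 (real (d i))) + f_lin n d x"
    "(real m - real k) * log 2 (real m - real k)
          - (\<Sum>i = 1..n. real (d i) * log 2 (real (d i))) + f_lin n d x
      \<le> f_ent n d m k x"
    by auto
next
  fix xhat assume "is_arg_min (f_lin n d) (\<lambda>x. x \<in> C) xhat"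
  then have xhat: "xhat \<in> C" and min: "\<And>x. x \<in> C \<Longrightarrow> f_lin n d xhat \<le> f_lin n d x"
    by (auto simp: is_arg_min_linorder)
  have fin: "finite C"
    using assms(3) finite_bounded_tuples by (rule finite_subset)
  \<comment> \<open>The middle expression at \<open>xhat\<close> lies above the left side; by
    minimality it is at most its value at \<open>x\<close>, which is at most
    \<open>f_ent n d m k x\<close>.\<close>
  have "f_ent n d m k xhat - real k / ln 2 \<le> f_ent n d m k x" if "x \<in> C" for x
    using f_ent_f_lin_bounds(1)[OF assms(1), of xhat k] f_ent_f_lin_bounds(2)[OF assms(1), of x k]
      min[OF that] xhat that assms(3) by force
  \<comment> \<open>\<open>Min\<close> is a true minimum here: \<open>C\<close> is finite, and
    \<open>xhat\<close> shows it nonempty.\<close>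
  then have "f_ent n d m k xhat - real k / ln 2 \<le> Min (f_ent n d m k ` C)"
    using fin xhat by (intro Min.boundedI) auto
  then show "f_ent n d m k xhat \<le> Min (f_ent n d m k ` C) + real k / ln 2"
    by simp
qed

end
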